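(* Let $f:\mathbb{R}^d\to\mathbb{R}$ be differentiable, convex and symmetrically $(L_0,L_1)$-smooth with $L_0>0$, $L_1>0$, and let $x^*\in\arg\min_{x\in\mathbb{R}^d} f(x)$. Let $\nu$ be the real number with $\nu=e^{-\nu}$, let $0<\eta\le \frac{\nu}{2}$, let $x^0\in\mathbb{R}^d$, and let $(x^k)_{k\ge 0}$ be the iterates of $(L_0,L_1)$-GD, $$x^{k+1}=x^k-\frac{\eta}{L_0+L_1\|\nabla f(x^k)\|}\nabla f(x^k).$$ Then for every $k\ge 0$ the following implication holds: $$\|\nabla f(x^k)\|\ge \frac{L_0}{L_1}\ \Longrightarrow\ k\le \frac{8L_1^2\|x^0-x^*\|^2}{\nu\eta}-1\ \text{ and }\ \|x^{k+1}-x^*\|^2\le \|x^k-x^*\|^2-\frac{\nu\eta}{8L_1^2}.$$ Moreover, for every $N>\frac{8L_1^2\|x^0-x^*\|^2}{\nu\eta}-1$ (with $N\ge 0$ an integer), the output $x^N$ after $N$ iterations satisfies $$f(x^N)-f(x^* )\le \frac{2L_0\|x^0-x^*\|^2}{\eta(N+1-T)}-\frac{\nu L_0T}{4L_1^2(N+1-T)}\le \frac{2L_0\|x^0-x^*\|^2}{\eta(N+1)},$$ where $T:=|\mathcal{T}|$ and $\mathcal{T}:=\{k\in\{0,1,\ldots,N-1\}\mid \|\nabla f(x^k)\|\ge \frac{L_0}{L_1}\}$.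
   Context: $\|\cdot\|$ is the Euclidean norm. A differentiable $f:\mathbb{R}^d\to\mathbb{R}$ is convex if $f(y)\ge f(x)+\langle\nabla f(x),y-x\rangle$ for all $x,y$. It is symmetrically $(L_0,L_1)$-smooth if for all $x,y\in\mathbb{R}^d$ $$\|\nabla f(x)-\nabla f(y)\|\le\Big(L_0+L_1\sup_{u\in[x,y]}\|\nabla f(u)\|\Big)\|x-y\|,$$ where $[x,y]$ is the line segment between $x$ and $y$. *)

theory Defs
  imports "HOL-Analysis.Analysis"
begin

definition grad :: "('a::real_inner \<Rightarrow> real) \<Rightarrow> 'a \<Rightarrow> 'a" where
  "grad f x = (THE D. GDERIV f x :> D)"

lemma grad_eqI:
  assumes "GDERIV f x :> D"
  shows "grad f x = D"
proof -
  have "D' = D" if "GDERIV f x :> D'" for D'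
  proof -
    have "(\<lambda>h. h \<bullet> D') = (\<lambda>h. h \<bullet> D)"
      using that assms unfolding gderiv_def by (rule has_derivative_unique)
    then have "h \<bullet> D' = h \<bullet> D" for h by meson
    then show ?thesis by (metis vector_eq_ldot)
  qed
  then show ?thesis
    unfolding grad_def using assms by blast
qed

lemma GDERIV_grad:
  fixes f :: "'a::euclidean_space \<Rightarrow> real"
  assumes "f differentiable (at x)"
  shows "GDERIV f x :> grad f x"
proof -
  obtain f' where f': "(f has_derivative f') (at x)"
    using assms unfolding differentiable_def by blast
  then interpret bounded_linear f' by (rule has_derivative_bounded_linear)
  have "f' h = h \<bullet> (\<Sum>b\<in>Basis. f' b *\<^sub>R b)" for h
  proof -
    have "f' h = f' (\<Sum>b\<in>Basis. (h \<bullet> b) *\<^sub>R b)"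
      by (simp add: euclidean_representation)
    then show ?thesis
      by (simp add: sum scale inner_sum_right mult.commute)
  qed
  then have "f' = (\<lambda>h. h \<bullet> (\<Sum>b\<in>Basis. f' b *\<^sub>R b))" by blast
  then have "GDERIV f x :> (\<Sum>b\<in>Basis. f' b *\<^sub>R b)"
    using f' unfolding gderiv_def by simp
  then show ?thesis using grad_eqI by metis
qed

text \<open>For differentiable functions, convexity in the sense of \<^const>\<open>convex_on\<close> is the
  first-order inequality.\<close>

lemma convex_on_UNIV_iff_grad:
  fixes f :: "'a::euclidean_space \<Rightarrow> real"
  assumes "f differentiable_on UNIV"
  shows "convex_on UNIV f \<longleftrightarrow> (\<forall>x y. f y \<ge> f x + grad f x \<bullet> (y - x))"
proof
  assume conv: "convex_on UNIV f"
  show "\<forall>x y. f y \<ge> f x + grad f x \<bullet> (y - x)"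
  proof (intro allI)
    fix x y
    define h where "h t = f (x + t *\<^sub>R (y - x))" for t :: real
    have "f differentiable (at x)"
      using assms by (simp add: differentiable_on_def)
    then have d: "(f has_derivative (\<lambda>h. h \<bullet> grad f x)) (at (x + 0 *\<^sub>R (y - x)))"
      using GDERIV_grad unfolding gderiv_def by simp
    have "((\<lambda>t. x + t *\<^sub>R (y - x)) has_derivative (\<lambda>t. t *\<^sub>R (y - x))) (at 0)"
      by (auto intro!: derivative_eq_intros)
    from has_derivative_compose[OF this d]
    have dh: "(h has_field_derivative (grad f x \<bullet> (y - x))) (at 0 within UNIV)"
      unfolding h_def has_field_derivative_def
      by (simp add: inner_commute mult.commute[of _ "grad f x \<bullet> (y - x)"])
    have ch: "convex_on UNIV h"
    proof (rule convex_onI)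
      fix t a b :: real assume "0 < t" "t < 1"
      moreover have "x + ((1 - t) *\<^sub>R a + t *\<^sub>R b) *\<^sub>R (y - x)
          = (1 - t) *\<^sub>R (x + a *\<^sub>R (y - x)) + t *\<^sub>R (x + b *\<^sub>R (y - x))"
        by (simp add: algebra_simps)
      ultimately show "h ((1 - t) *\<^sub>R a + t *\<^sub>R b) \<le> (1 - t) * h a + t * h b"
        unfolding h_def using convex_onD[OF conv, of t] by simp
    qed auto
    have "h 1 - h 0 \<ge> (grad f x \<bullet> (y - x)) * (1 - 0)"
      by (rule convex_on_imp_above_tangent[OF ch _ _ _ dh]) auto
    then show "f y \<ge> f x + grad f x \<bullet> (y - x)" by (simp add: h_def)
  qed
next
  assume *: "\<forall>x y. f y \<ge> f x + grad f x \<bullet> (y - x)"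
  show "convex_on UNIV f"
  proof (rule convex_onI)
    fix t :: real and x y :: 'a assume t: "0 < t" "t < 1"
    define z where "z = (1 - t) *\<^sub>R x + t *\<^sub>R y"
    have "(1 - t) * f x \<ge> (1 - t) * (f z + grad f z \<bullet> (x - z))"
      "t * f y \<ge> t * (f z + grad f z \<bullet> (y - z))"
      using * t by (auto intro!: mult_left_mono)
    moreover have "(1 - t) * (f z + grad f z \<bullet> (x - z)) + t * (f z + grad f z \<bullet> (y - z))
        = f z + grad f z \<bullet> ((1 - t) *\<^sub>R (x - z) + t *\<^sub>R (y - z))"
      by (simp add: inner_add_right algebra_simps)
    moreover have "(1 - t) *\<^sub>R (x - z) + t *\<^sub>R (y - z) = 0"
      by (simp add: z_def algebra_simps)
    ultimately show "f ((1 - t) *\<^sub>R x + t *\<^sub>R y) \<le> (1 - t) * f x + t * f y"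
      unfolding z_def[symmetric] by simp
  qed auto
qed

text \<open>The supremum is taken in the extended reals: the gradient of a merely differentiable
  function may be unbounded on a segment, and the supremum is then infinite.\<close>

definition symmetrically_smooth :: "real \<Rightarrow> real \<Rightarrow> ('a::real_inner \<Rightarrow> real) \<Rightarrow> bool" where
  "symmetrically_smooth L0 L1 f \<longleftrightarrow>
    (\<forall>x y. ereal (norm (grad f x - grad f y)) \<le>
      (ereal L0 + ereal L1 * (SUP u\<in>closed_segment x y. ereal (norm (grad f u))))
        * ereal (norm (x - y)))"

end

theory Submission
  imports Defs
begin

text \<open>Let \<open>G y = L0 + L1 * norm (grad f y)\<close>. Along a segment starting at \<open>y\<close>, the running supremum of
  \<open>L0 + L1 * norm (grad f u)\<close> grows by a factor of at most \<open>1 / (1 - c / n)\<close> over each \<open>n\<close>-th part,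
  where \<open>c = L1 * norm (z - y)\<close>; hence \<open>norm (grad f z - grad f y) \<le> G y * exp c * norm (z - y)\<close>.
  Integrating, and decreasing \<open>f z - grad f x \<bullet> z\<close> by a gradient step of length \<open>\<nu> / G y\<close> from \<open>y\<close>, gives
  the lower bound \<open>\<nu> / (2 * G y) * (norm (grad f y - grad f x))\<^sup>2\<close> for the Bregman divergence.
  With \<open>x = xstar\<close> it yields the descent of the distance to \<open>xstar\<close>; with \<open>y\<close>, \<open>x\<close> two consecutive
  iterates it yields that the gradient norms decrease, so that the large gradients all come first.\<close>

section \<open>Setting and elementary facts about the gradient\<close>

locale convex_symmetrically_smooth =
  fixes f :: "'a::euclidean_space \<Rightarrow> real" and L0 L1 :: real
  assumes differentiable: "f differentiable_on UNIV"
    and convex: "convex_on UNIV f"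
    and L0_pos: "L0 > 0" and L1_pos: "L1 > 0"
    and smooth: "symmetrically_smooth L0 L1 f"
begin

text \<open>The local smoothness constant; the step size of the method at \<open>x\<close> is
  \<open>\<eta> / G x\<close>.\<close>

definition G :: "'a \<Rightarrow> real" where
  "G x = L0 + L1 * norm (grad f x)"

lemma G_pos: "G x > 0"
  using L0_pos L1_pos by (simp add: G_def add_pos_nonneg)

lemma convex_grad: "f x + grad f x \<bullet> (y - x) \<le> f y"
  using convex_on_UNIV_iff_grad[OF differentiable] convex by blast

lemma has_derivative_grad: "(f has_derivative (\<lambda>h. h \<bullet> grad f x)) (at x)"
  using GDERIV_grad[of f x] differentiable
  by (simp add: gderiv_def differentiable_on_def)

lemma has_real_derivative_segment:
  "((\<lambda>t. f (y + t *\<^sub>R d)) has_real_derivative (grad f (y + t *\<^sub>R d) \<bullet> d)) (at t)"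
proof -
  have "((\<lambda>t. y + t *\<^sub>R d) has_derivative (\<lambda>t. t *\<^sub>R d)) (at t)"
    by (auto intro!: derivative_eq_intros)
  from has_derivative_compose[OF this has_derivative_grad]
  show ?thesis
    by (simp add: has_field_derivative_def inner_commute mult_commute_abs)
qed

lemma grad_minimum_eq_0:
  assumes "\<And>y. f x \<le> f y"
  shows "grad f x = 0"
proof -
  have "(\<lambda>h. h \<bullet> grad f x) = (\<lambda>_. 0)"
    by (rule differential_zero_maxmin[of x UNIV, OF _ _ has_derivative_grad]) (auto simp: assms)
  then have "grad f x \<bullet> grad f x = 0"
    by meson
  then show ?thesis by simp
qed

text \<open>By convexity, a step along the normalized gradient raises \<open>f\<close> by at least
  the gradient norm, while \<open>f\<close> is bounded on the closed unit neighbourhood of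
  \<open>S\<close>. As \<open>sgn 0 = 0\<close>, a vanishing gradient is no special case. This makes
  suprema of gradient norms along segments finite.\<close>

lemma bounded_grad_compact:
  assumes "compact S"
  obtains B where "\<And>u. u \<in> S \<Longrightarrow> norm (grad f u) \<le> B"
proof -
  have cont: "continuous_on A f" for A
    using differentiable differentiable_imp_continuous_on continuous_on_subset by blast
  let ?S = "{u + v |u v. u \<in> S \<and> v \<in> cball 0 1}"
  have "bounded (f ` ?S)"
    by (intro compact_imp_bounded compact_continuous_image cont compact_sums assms compact_cball)
  then obtain B where B: "\<And>u. u \<in> ?S \<Longrightarrow> \<bar>f u\<bar> \<le> B"
    unfolding bounded_iff by auto
  have "norm (grad f u) \<le> 2 * B" if u: "u \<in> S" for u
  proof -
    let ?v = "sgn (grad f u)"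
    have "norm ?v \<le> 1" by (simp add: norm_sgn)
    then have "\<bar>f (u + ?v)\<bar> \<le> B" "\<bar>f (u + 0)\<bar> \<le> B"
      by (intro B; use u in force)+
    moreover have "grad f u \<bullet> ?v = norm (grad f u)"
      by (simp add: sgn_div_norm dot_square_norm power2_eq_square divide_simps)
    moreover have "f u + grad f u \<bullet> ?v \<le> f (u + ?v)"
      using convex_grad[of u "u + ?v"] by simp
    ultimately show ?thesis by simp
  qed
  then show ?thesis using that by blast
qed

section \<open>Exponential growth bound for the gradient\<close>

lemma grad_diff_le:
  assumes "\<And>u. u \<in> closed_segment x y \<Longrightarrow> norm (grad f u) \<le> B"
  shows "norm (grad f x - grad f y) \<le> (L0 + L1 * B) * norm (x - y)"
proof -
  let ?S = "SUP u\<in>closed_segment x y. ereal (norm (grad f u))"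
  have "?S \<le> ereal B"
    by (rule SUP_least) (simp add: assms)
  then have "(ereal L0 + ereal L1 * ?S) * ereal (norm (x - y))
      \<le> (ereal L0 + ereal L1 * ereal B) * ereal (norm (x - y))"
    using L1_pos by (intro ereal_mult_right_mono add_left_mono ereal_mult_left_mono) auto
  with smooth have "ereal (norm (grad f x - grad f y))
      \<le> (ereal L0 + ereal L1 * ereal B) * ereal (norm (x - y))"
    unfolding symmetrically_smooth_def using order_trans by blast
  then show ?thesis by simp
qed

lemma grad_diff_le_exp:
  "norm (grad f x - grad f y) \<le> G y * exp (L1 * norm (x - y)) * norm (x - y)"
proof -
  define d where "d = x - y"
  define c where "c = L1 * norm d"
  define u where "u t = norm (grad f (y + t *\<^sub>R d))" for t :: real
  \<comment> \<open>\<open>M t\<close> is the running supremum of the gradient norm between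
    \<open>y\<close> and \<open>y + t *\<^sub>R d\<close>, so \<open>a t\<close> is a Lipschitz
    constant of the gradient on that stretch, with \<open>a 0 = G y\<close>.\<close>
  define M where "M t = (SUP s\<in>{0..t}. u s)" for t
  define a where "a t = L0 + L1 * M t" for t
  have seg: "\<exists>r\<in>{s..t}. v = y + r *\<^sub>R d"
    if "v \<in> closed_segment (y + t *\<^sub>R d) (y + s *\<^sub>R d)" "s \<le> t" for v s t
  proof -
    have "closed_segment (y + t *\<^sub>R d) (y + s *\<^sub>R d) = (\<lambda>r. y + r *\<^sub>R d) ` closed_segment t s"
      using closed_segment_linear_image[of "\<lambda>r. r *\<^sub>R d" t s]
        closed_segment_translation[of y "t *\<^sub>R d" "s *\<^sub>R d"]
      by (simp add: linear_scaleR_left image_image)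
    then show ?thesis
      using that by (auto simp: closed_segment_eq_real_ivl split: if_splits)
  qed
  have bdd: "bdd_above (u ` {0..t})" for t
  proof -
    have "compact ((\<lambda>s. y + s *\<^sub>R d) ` {0..t})"
      by (intro compact_continuous_image continuous_intros) simp
    then obtain B where "\<And>v. v \<in> (\<lambda>s. y + s *\<^sub>R d) ` {0..t} \<Longrightarrow> norm (grad f v) \<le> B"
      by (rule bounded_grad_compact) blast
    then show ?thesis by (intro bdd_aboveI[of _ B]) (auto simp: u_def)
  qed
  have u_le: "u r \<le> M t" if "0 \<le> r" "r \<le> t" for r t
    unfolding M_def by (rule cSUP_upper[OF _ bdd]) (use that in auto)
  have diff: "norm (grad f (y + t *\<^sub>R d) - grad f (y + s *\<^sub>R d)) \<le> a t * ((t - s) * norm d)"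
    if "0 \<le> s" "s \<le> t" for s t
  proof -
    have "norm (grad f v) \<le> M t"
      if "v \<in> closed_segment (y + t *\<^sub>R d) (y + s *\<^sub>R d)" for v
      using seg[OF that \<open>s \<le> t\<close>] u_le \<open>0 \<le> s\<close> unfolding u_def by force
    then have "norm (grad f (y + t *\<^sub>R d) - grad f (y + s *\<^sub>R d))
        \<le> (L0 + L1 * M t) * norm ((y + t *\<^sub>R d) - (y + s *\<^sub>R d))"
      by (rule grad_diff_le)
    then show ?thesis
      using \<open>s \<le> t\<close> by (simp add: a_def scaleR_diff_left[symmetric])
  qed
  have M_nonneg: "0 \<le> M t" if "0 \<le> t" for t
    using u_le[of 0 t] that by (smt (verit) norm_ge_zero u_def)
  have a_pos: "0 < a t" if "0 \<le> t" for t
    using M_nonneg[OF that] L0_pos L1_pos by (simp add: a_def add_pos_nonneg)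
  \<comment> \<open>Up to \<open>s\<close> the gradient norm is at most \<open>M s\<close>; beyond
    \<open>s\<close> it grows by at most the Lipschitz bound measured from \<open>s\<close>. So
    \<open>M t\<close> is bounded by \<open>M s\<close> plus a multiple of \<open>a t\<close>
    itself, which moves to the left as the factor \<open>1 - c * (t - s)\<close>.\<close>
  have step: "a t * (1 - c * (t - s)) \<le> a s" if st: "0 \<le> s" "s \<le> t" for s t
  proof -
    have "u r \<le> M s + a t * ((t - s) * norm d)" if r: "r \<in> {0..t}" for r
    proof (cases "r \<le> s")
      case True
      have "0 \<le> a t * ((t - s) * norm d)"
        using a_pos[of t] st by simp
      then show ?thesis using u_le[of r s] r True by simp
    next
      case False
      have "M r \<le> M t"
        unfolding M_def by (rule cSUP_subset_mono[OF _ bdd]) (use r in auto)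
      then have "a r * ((r - s) * norm d) \<le> a t * ((t - s) * norm d)"
        using r False st L1_pos a_pos[of t]
        by (intro mult_mono mult_right_mono) (auto simp: a_def)
      moreover have "u r \<le> u s + a r * ((r - s) * norm d)"
        unfolding u_def using diff[of s r] False st
          norm_triangle_sub[of "grad f (y + r *\<^sub>R d)" "grad f (y + s *\<^sub>R d)"] by simp
      ultimately show ?thesis using u_le[of s s] st by simp
    qed
    then have "M t \<le> M s + a t * ((t - s) * norm d)"
      unfolding M_def[of t] by (intro cSUP_least) (use st in auto)
    then have "L1 * M t \<le> L1 * (M s + a t * ((t - s) * norm d))"
      using L1_pos by simp
    then show ?thesis by (simp add: a_def c_def algebra_simps)
  qed
  \<comment> \<open>\<open>step\<close> is chained over \<open>n\<close> equal parts of the unit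
    interval; \<open>n > c\<close> keeps \<open>1 - c / n\<close> nonnegative, so the inequalities
    can be multiplied. The limit in \<open>n\<close> then produces \<open>exp (- c)\<close>.\<close>
  have power: "a 1 * (1 + (- c) / real n) ^ n \<le> a 0" if n: "real n > c" "n > 0" for n
  proof -
    have q: "0 \<le> 1 - c / n" using n by (simp add: field_simps)
    have "a (real k / n) * (1 - c / n) ^ k \<le> a 0" if "k \<le> n" for k
      using that
    proof (induction k)
      case (Suc k)
      have "a (real (Suc k) / n) * (1 - c * (real (Suc k) / n - real k / n)) \<le> a (real k / n)"
        by (rule step) (auto simp: divide_right_mono)
      moreover have "real (Suc k) / n - real k / n = 1 / n"
        by (simp add: add_divide_distrib)
      ultimately have "a (real (Suc k) / n) * (1 - c / n) \<le> a (real k / n)"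
        by simp
      from mult_right_mono[OF this, of "(1 - c / n) ^ k"] q Suc
      show ?case by (simp add: mult.assoc)
    qed simp
    from this[of n] n show ?thesis by simp
  qed
  have "(\<lambda>n. a 1 * (1 + (- c) / real n) ^ n) \<longlonglongrightarrow> a 1 * exp (- c)"
    by (intro tendsto_mult_left tendsto_exp_limit_sequentially)
  moreover have "\<forall>\<^sub>F n in sequentially. a 1 * (1 + (- c) / real n) ^ n \<le> a 0"
    using eventually_gt_at_top[of "nat \<lceil>c\<rceil>"]
    by eventually_elim (rule power; linarith)
  ultimately have "a 1 * exp (- c) \<le> a 0"
    by (rule tendsto_upperbound) simp
  then have "a 1 \<le> a 0 * exp c"
    by (simp add: exp_minus field_simps)
  moreover have "a 0 = G y"
    by (simp add: a_def M_def u_def G_def)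
  moreover have "norm (grad f x - grad f y) \<le> a 1 * norm d"
    using diff[of 0 1] by (simp add: d_def)
  ultimately show ?thesis
    using mult_right_mono[of "a 1" "G y * exp c" "norm d"] by (simp add: c_def d_def)
qed

section \<open>Descent inequality and lower bound on the Bregman divergence\<close>

lemma descent:
  "f z \<le> f y + grad f y \<bullet> (z - y) + G y / 2 * exp (L1 * norm (z - y)) * (norm (z - y))\<^sup>2"
proof -
  define d where "d = z - y"
  define K where "K = G y * exp (L1 * norm d) * (norm d)\<^sup>2"
  \<comment> \<open>Monotonicity of \<open>h\<close> replaces integration: the quadratic has
    derivative \<open>K * t\<close>, which dominates the growth of the directional derivative,
    because the exponential in \<open>K\<close> is taken at the full length
    \<open>norm d\<close>.\<close>
  define h where "h t = f (y + t *\<^sub>R d) - t * (grad f y \<bullet> d) - K * t\<^sup>2 / 2" for t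
  have "h 1 \<le> h 0"
  proof (rule DERIV_nonpos_imp_nonincreasing[of 0 1 h])
    fix t :: real assume t: "0 \<le> t" "t \<le> 1"
    have "(h has_real_derivative (grad f (y + t *\<^sub>R d) \<bullet> d - grad f y \<bullet> d - K * t)) (at t)"
      unfolding h_def by (auto intro!: derivative_eq_intros has_real_derivative_segment)
    moreover have "grad f (y + t *\<^sub>R d) \<bullet> d - grad f y \<bullet> d \<le> K * t"
    proof -
      have "(grad f (y + t *\<^sub>R d) - grad f y) \<bullet> d \<le> norm (grad f (y + t *\<^sub>R d) - grad f y) * norm d"
        by (rule norm_cauchy_schwarz)
      also have "\<dots> \<le> (G y * exp (L1 * norm (t *\<^sub>R d)) * norm (t *\<^sub>R d)) * norm d"
        using grad_diff_le_exp[of "y + t *\<^sub>R d" y] by (intro mult_right_mono) auto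
      also have "\<dots> \<le> (G y * exp (L1 * norm d) * norm (t *\<^sub>R d)) * norm d"
        using t G_pos[of y] L1_pos
        by (intro mult_right_mono mult_left_mono) (auto simp: mult_left_le_one_le)
      also have "\<dots> = K * t"
        using t by (simp add: K_def power2_eq_square)
      finally show ?thesis by (simp add: inner_diff_left)
    qed
    ultimately show "\<exists>D. (h has_real_derivative D) (at t) \<and> D \<le> 0"
      by force
  qed simp
  then show ?thesis by (simp add: h_def K_def d_def)
qed

text \<open>Convexity makes \<open>x\<close> a minimizer of \<open>f\<close> minus the linear
  function given by \<open>grad f x\<close>, so the decrease achieved at \<open>z\<close> bounds the
  divergence from below. The condition \<open>le\<close> keeps \<open>L1 * norm (z - y)\<close> at
  most \<nu>.\<close>

lemma bregman_ge:
  assumes \<nu>: "\<nu> = exp (- \<nu>)"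
    and le: "L1 * norm (grad f y - grad f x) \<le> G y"
  shows "\<nu> / (2 * G y) * (norm (grad f y - grad f x))\<^sup>2 \<le> f y - f x - grad f x \<bullet> (y - x)"
proof -
  define D where "D = grad f y - grad f x"
  \<comment> \<open>With \<open>G y * t = \<nu>\<close> and \<open>\<nu> * exp \<nu> = 1\<close>,
    the quadratic term of \<open>descent\<close> is half of the linear decrease
    \<open>t * (norm D)\<^sup>2\<close>.\<close>
  define t where "t = \<nu> / G y"
  define z where "z = y - t *\<^sub>R D"
  have \<nu>_pos: "0 < \<nu>" by (subst \<nu>) simp
  have \<nu>_exp: "\<nu> * exp \<nu> = 1"
    by (metis \<nu> exp_minus_inverse mult.commute)
  have t: "0 \<le> t" "G y * t = \<nu>"
    using \<nu>_pos G_pos[of y] by (auto simp: t_def)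
  have nz: "norm (z - y) = t * norm D"
    using t by (simp add: z_def)
  have "t * (L1 * norm D) \<le> t * G y"
    using le t by (intro mult_left_mono) (auto simp: D_def)
  then have e: "exp (L1 * norm (z - y)) \<le> exp \<nu>"
    using t by (simp add: nz mult_ac)
  have "f x + grad f x \<bullet> (z - x) \<le> f z"
    by (rule convex_grad)
  also have "f z \<le> f y + grad f y \<bullet> (z - y) + G y / 2 * exp (L1 * norm (z - y)) * (norm (z - y))\<^sup>2"
    by (rule descent)
  also have "\<dots> \<le> f y + grad f y \<bullet> (z - y) + G y / 2 * exp \<nu> * (norm (z - y))\<^sup>2"
    using e G_pos[of y] by (intro add_left_mono mult_right_mono mult_left_mono) auto
  also have "G y / 2 * exp \<nu> * (norm (z - y))\<^sup>2 = (G y * t) * exp \<nu> * t * (norm D)\<^sup>2 / 2"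
    by (simp add: nz power2_eq_square)
  also have "\<dots> = t * (norm D)\<^sup>2 / 2"
    using t \<nu>_exp by simp
  finally have "f x + grad f x \<bullet> (z - x) \<le> f y + grad f y \<bullet> (z - y) + t * (norm D)\<^sup>2 / 2" .
  moreover have "grad f y \<bullet> (z - y) - grad f x \<bullet> (z - x) = - t * (norm D)\<^sup>2 - grad f x \<bullet> (y - x)"
  proof -
    have "grad f y \<bullet> (z - y) - grad f x \<bullet> (z - x) = D \<bullet> (z - y) - grad f x \<bullet> (y - x)"
      by (simp add: D_def inner_diff_left inner_diff_right)
    also have "D \<bullet> (z - y) = - t * (norm D)\<^sup>2"
      by (simp add: z_def power2_norm_eq_inner)
    finally show ?thesis .
  qed
  ultimately have "t * (norm D)\<^sup>2 / 2 \<le> f y - f x - grad f x \<bullet> (y - x)"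
    by simp
  then show ?thesis by (simp add: t_def D_def)
qed

lemma suboptimality_ge:
  assumes "\<nu> = exp (- \<nu>)" and "\<And>z. f xstar \<le> f z"
  shows "\<nu> / (2 * G y) * (norm (grad f y))\<^sup>2 \<le> f y - f xstar"
  using bregman_ge[OF assms(1), of y xstar] grad_minimum_eq_0[OF assms(2)] L0_pos
  by (simp add: G_def)

section \<open>One gradient step: values and gradient norms\<close>

context
  fixes \<nu> \<eta> :: real
  assumes \<nu>: "\<nu> = exp (- \<nu>)" and \<eta>_pos: "0 < \<eta>" and \<eta>_le: "\<eta> \<le> \<nu> / 2"
begin

definition gd_step :: "'a \<Rightarrow> 'a" where
  "gd_step x = x - (\<eta> / G x) *\<^sub>R grad f x"

text \<open>The step has length at most \<open>\<eta> / L1\<close>, so the exponential is at most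
  \<open>exp \<nu>\<close>, and \<open>\<eta> * exp \<nu>\<close> is at most 1. Both monotonicity
  results below start from this bound.\<close>

lemma grad_gd_step_diff_le:
  "norm (grad f (gd_step x) - grad f x) \<le> norm (grad f x)"
proof -
  have n: "norm (gd_step x - x) = \<eta> / G x * norm (grad f x)"
    using \<eta>_pos G_pos[of x] by (simp add: gd_step_def)
  have "L1 * norm (grad f x) \<le> G x"
    using L0_pos by (simp add: G_def)
  then have "L1 * norm (gd_step x - x) \<le> \<eta>"
    using \<eta>_pos G_pos[of x] by (simp add: n field_simps)
  also have "\<eta> \<le> \<nu>" using \<eta>_pos \<eta>_le by simp
  finally have "exp (L1 * norm (gd_step x - x)) \<le> exp \<nu>" by simp
  moreover have "\<eta> * exp \<nu> \<le> 1"
  proof -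
    have "\<eta> * exp \<nu> \<le> \<nu> * exp \<nu>" using \<open>\<eta> \<le> \<nu>\<close> by simp
    also have "\<dots> = 1" by (metis \<nu> exp_minus_inverse mult.commute)
    finally show ?thesis .
  qed
  ultimately have "\<eta> * exp (L1 * norm (gd_step x - x)) \<le> 1"
    using \<eta>_pos by (smt (verit) mult_left_mono)
  then have "\<eta> * exp (L1 * norm (gd_step x - x)) * norm (grad f x) \<le> 1 * norm (grad f x)"
    by (rule mult_right_mono) simp
  moreover have "G x * exp (L1 * norm (gd_step x - x)) * norm (gd_step x - x)
      = \<eta> * exp (L1 * norm (gd_step x - x)) * norm (grad f x)"
    using G_pos[of x] by (simp add: n)
  ultimately show ?thesis
    using grad_diff_le_exp[of "gd_step x" x] by linarith
qed

text \<open>Expanding the square of the preceding bound shows that the old and new gradients have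
  nonnegative inner product; convexity at the new point then compares the values.\<close>

lemma f_gd_step_le: "f (gd_step x) \<le> f x"
proof -
  have "(norm (grad f (gd_step x) - grad f x))\<^sup>2 \<le> (norm (grad f x))\<^sup>2"
    by (intro power_mono grad_gd_step_diff_le) simp
  then have "grad f (gd_step x) \<bullet> grad f (gd_step x) \<le> 2 * (grad f (gd_step x) \<bullet> grad f x)"
    by (simp add: power2_norm_eq_inner inner_diff_left inner_diff_right inner_commute)
  then have "0 \<le> grad f (gd_step x) \<bullet> grad f x"
    by (smt (verit) inner_ge_zero)
  then have "0 \<le> grad f (gd_step x) \<bullet> (x - gd_step x)"
    using \<eta>_pos G_pos[of x] by (simp add: gd_step_def)
  then show ?thesis
    using convex_grad[of "gd_step x" x] by simp
qed

text \<open>The lower bound on one Bregman divergence and the nonnegativity of the opposite one add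
  up to cocoercivity along the step. With \<open>\<eta> \<le> \<nu> / 2\<close> this becomes
  \<open>(norm D)\<^sup>2 \<le> D \<bullet> grad f x\<close>, and expanding the square of
  \<open>grad f x - D\<close> finishes.\<close>

lemma norm_grad_gd_step_le: "norm (grad f (gd_step x)) \<le> norm (grad f x)"
proof -
  define D where "D = grad f x - grad f (gd_step x)"
  have "L1 * norm D \<le> L1 * norm (grad f x)"
    using grad_gd_step_diff_le[of x] L1_pos by (simp add: D_def norm_minus_commute)
  also have "\<dots> \<le> G x"
    using L0_pos by (simp add: G_def)
  finally have "\<nu> / (2 * G x) * (norm D)\<^sup>2
      \<le> f x - f (gd_step x) - grad f (gd_step x) \<bullet> (x - gd_step x)"
    unfolding D_def by (rule bregman_ge[OF \<nu>])
  also have "\<dots> \<le> D \<bullet> (x - gd_step x)"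
    using convex_grad[of x "gd_step x"] by (simp add: D_def inner_diff_left inner_diff_right)
  also have "\<dots> = \<eta> / G x * (D \<bullet> grad f x)"
    by (simp add: gd_step_def)
  finally have "\<nu> / 2 * (norm D)\<^sup>2 \<le> \<eta> * (D \<bullet> grad f x)"
    using G_pos[of x] by (simp add: field_simps)
  moreover have "\<eta> * (norm D)\<^sup>2 \<le> \<nu> / 2 * (norm D)\<^sup>2"
    using \<eta>_le by (intro mult_right_mono) auto
  ultimately have "\<eta> * (norm D)\<^sup>2 \<le> \<eta> * (D \<bullet> grad f x)"
    by simp
  then have "(norm D)\<^sup>2 \<le> D \<bullet> grad f x"
    using \<eta>_pos by simp
  moreover have "0 \<le> (norm D)\<^sup>2" by simp
  moreover have "(norm (grad f (gd_step x)))\<^sup>2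
      = (norm (grad f x))\<^sup>2 - 2 * (D \<bullet> grad f x) + (norm D)\<^sup>2"
    by (simp add: D_def power2_norm_eq_inner inner_diff_left inner_diff_right inner_commute)
  ultimately have "(norm (grad f (gd_step x)))\<^sup>2 \<le> (norm (grad f x))\<^sup>2"
    by linarith
  then show ?thesis by (rule power2_le_imp_le) simp
qed

section \<open>One gradient step: distance to a minimizer\<close>

context
  fixes xstar :: 'a
  assumes min: "\<And>z. f xstar \<le> f z"
begin

text \<open>In the expanded square the linear term gains at least \<open>2 * h * F\<close> by
  convexity; the quadratic term costs at most \<open>h * F\<close>, by
  \<open>suboptimality_ge\<close> and \<open>\<eta> \<le> \<nu> / 2\<close>.\<close>

lemma dist_gd_step:
  "(norm (gd_step x - xstar))\<^sup>2 \<le> (norm (x - xstar))\<^sup>2 - \<eta> / G x * (f x - f xstar)"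
proof -
  define g where "g = grad f x"
  define F where "F = f x - f xstar"
  define h where "h = \<eta> / G x"
  have h: "0 < h" using \<eta>_pos G_pos[of x] by (simp add: h_def)
  have F: "0 \<le> F" using min by (simp add: F_def)
  have "gd_step x - xstar = (x - xstar) - h *\<^sub>R g"
    by (simp add: gd_step_def g_def h_def)
  then have "(norm (gd_step x - xstar))\<^sup>2
      = (norm (x - xstar))\<^sup>2 - 2 * h * (g \<bullet> (x - xstar)) + h * (h * (norm g)\<^sup>2)"
    by (simp only: power2_norm_eq_inner) (simp add: inner_commute algebra_simps)
  moreover have "h * F \<le> h * (g \<bullet> (x - xstar))"
    using h convex_grad[of x xstar] by (simp add: g_def F_def inner_diff_right)
  moreover have "h * (norm g)\<^sup>2 \<le> F"
  proof -
    have "\<eta> / G x * (norm g)\<^sup>2 \<le> (\<nu> / 2) / G x * (norm g)\<^sup>2"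
      using \<eta>_le G_pos[of x] by (intro mult_right_mono divide_right_mono) auto
    also have "\<dots> \<le> F"
      using suboptimality_ge[OF \<nu> min, of x] by (simp add: g_def F_def)
    finally show ?thesis by (simp add: h_def)
  qed
  then have "h * (h * (norm g)\<^sup>2) \<le> h * F"
    using h by simp
  ultimately show ?thesis by (simp add: h_def F_def)
qed

text \<open>Here \<open>G x \<le> 2 * L1 * n\<close>, and the guaranteed decrease is proportional to
  \<open>n\<^sup>2 / (G x)\<^sup>2\<close>, hence bounded below independently of
  \<open>n\<close>.\<close>

lemma dist_gd_step_large_grad:
  assumes "L0 / L1 \<le> norm (grad f x)"
  shows "(norm (gd_step x - xstar))\<^sup>2 \<le> (norm (x - xstar))\<^sup>2 - \<nu> * \<eta> / (8 * L1\<^sup>2)"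
proof -
  define n where "n = norm (grad f x)"
  have \<nu>_pos: "0 < \<nu>" by (subst \<nu>) simp
  have "0 < L0 / L1" using L0_pos L1_pos by simp
  then have n: "0 < n" using assms unfolding n_def by (rule less_le_trans)
  have "L0 \<le> L1 * n"
    using assms L1_pos by (simp add: n_def field_simps)
  then have "G x \<le> 2 * L1 * n" by (simp add: G_def n_def)
  then have "(G x)\<^sup>2 \<le> (2 * L1 * n)\<^sup>2"
    using G_pos[of x] by (intro power_mono) auto
  then have "1 / (4 * L1\<^sup>2) \<le> n\<^sup>2 / (G x)\<^sup>2"
    using L1_pos G_pos[of x] by (simp add: field_simps)
  then have "\<nu> * \<eta> / 2 * (1 / (4 * L1\<^sup>2)) \<le> \<nu> * \<eta> / 2 * (n\<^sup>2 / (G x)\<^sup>2)"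
    using \<nu>_pos \<eta>_pos by (intro mult_left_mono) auto
  also have "\<dots> = \<eta> / G x * (\<nu> / (2 * G x) * n\<^sup>2)"
    by (simp add: power2_eq_square mult_ac)
  also have "\<dots> \<le> \<eta> / G x * (f x - f xstar)"
    using \<eta>_pos G_pos[of x] suboptimality_ge[OF \<nu> min, of x]
    by (intro mult_left_mono) (auto simp: n_def)
  finally show ?thesis using dist_gd_step[of x] by simp
qed

text \<open>In this regime \<open>G x\<close> stays below \<open>2 * L0\<close>.\<close>

lemma dist_gd_step_small_grad:
  assumes "norm (grad f x) < L0 / L1"
  shows "(norm (gd_step x - xstar))\<^sup>2 \<le> (norm (x - xstar))\<^sup>2 - \<eta> / (2 * L0) * (f x - f xstar)"
proof -
  have "L1 * norm (grad f x) < L0"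
    using assms L1_pos by (simp add: field_simps)
  then have "\<eta> / (2 * L0) \<le> \<eta> / G x"
    using \<eta>_pos G_pos[of x] L0_pos by (intro divide_left_mono) (auto simp: G_def)
  then have "\<eta> / (2 * L0) * (f x - f xstar) \<le> \<eta> / G x * (f x - f xstar)"
    using min by (intro mult_right_mono) auto
  then show ?thesis using dist_gd_step[of x] by simp
qed

section \<open>The sequence of iterates\<close>

context
  fixes x :: "nat \<Rightarrow> 'a"
  assumes step: "\<And>k. x (Suc k) = gd_step (x k)"
begin

lemma norm_grad_iterates_antimono:
  "j \<le> k \<Longrightarrow> norm (grad f (x k)) \<le> norm (grad f (x j))"
  by (rule lift_Suc_antimono_le[of "\<lambda>k. norm (grad f (x k))"])
    (simp_all add: step norm_grad_gd_step_le)

lemma f_iterates_antimono: "j \<le> k \<Longrightarrow> f (x k) \<le> f (x j)"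
  by (rule lift_Suc_antimono_le[of "\<lambda>k. f (x k)"]) (simp_all add: step f_gd_step_le)

text \<open>Sums the decreases of the first \<open>m\<close> steps. Every step with a small gradient
  is charged the gap at \<open>x N\<close>, which is legitimate because values decrease and all
  indices below \<open>m\<close> are at most \<open>N\<close>.\<close>

lemma dist_iterates:
  assumes "m \<le> Suc N"
  shows "(norm (x m - xstar))\<^sup>2 + real (card {k\<in>{..<m}. L0 / L1 \<le> norm (grad f (x k))}) * (\<nu> * \<eta> / (8 * L1\<^sup>2))
      + real (card {k\<in>{..<m}. \<not> L0 / L1 \<le> norm (grad f (x k))}) * (\<eta> / (2 * L0) * (f (x N) - f xstar))
    \<le> (norm (x 0 - xstar))\<^sup>2"
  using assms
proof (induction m)
  case (Suc m)
  have split: "real (card {k\<in>{..<Suc m}. P k}) = real (card {k\<in>{..<m}. P k}) + of_bool (P m)" for P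
  proof -
    have "{k\<in>{..<Suc m}. P k} = (if P m then insert m {k\<in>{..<m}. P k} else {k\<in>{..<m}. P k})"
      by (auto simp: less_Suc_eq)
    then show ?thesis by simp
  qed
  show ?case
  proof (cases "L0 / L1 \<le> norm (grad f (x m))")
    case True
    then show ?thesis
      using Suc dist_gd_step_large_grad[OF True]
      unfolding split by (simp add: step distrib_right add_divide_distrib)
  next
    case False
    have "\<eta> / (2 * L0) * (f (x N) - f xstar) \<le> \<eta> / (2 * L0) * (f (x m) - f xstar)"
      using f_iterates_antimono[of m N] Suc.prems \<eta>_pos L0_pos by (intro mult_left_mono) auto
    then show ?thesis
      using Suc False dist_gd_step_small_grad[of "x m"]
      unfolding split by (simp add: step distrib_right add_divide_distrib)
  qed
qed simp

text \<open>Gradient norms decrease, so a large gradient at \<open>k\<close> makes all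
  \<open>Suc k\<close> steps from 0 to \<open>k\<close> large, and each uses up a fixed share of the
  initial squared distance. The \<open>- 1\<close> accounts for index 0.\<close>

lemma large_grad_index_le:
  assumes "L0 / L1 \<le> norm (grad f (x k))"
  shows "real k \<le> 8 * L1\<^sup>2 * (norm (x 0 - xstar))\<^sup>2 / (\<nu> * \<eta>) - 1"
proof -
  have \<nu>_pos: "0 < \<nu>" by (subst \<nu>) simp
  have all: "L0 / L1 \<le> norm (grad f (x j))" if "j < Suc k" for j
    using norm_grad_iterates_antimono[of j k] that assms by simp
  then have "{j\<in>{..<Suc k}. L0 / L1 \<le> norm (grad f (x j))} = {..<Suc k}"
    "{j\<in>{..<Suc k}. \<not> L0 / L1 \<le> norm (grad f (x j))} = {}"
    by blast+
  with dist_iterates[of "Suc k" k]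
  have "(norm (x (Suc k) - xstar))\<^sup>2 + real (Suc k) * (\<nu> * \<eta> / (8 * L1\<^sup>2)) \<le> (norm (x 0 - xstar))\<^sup>2"
    by (simp only: card_lessThan card.empty of_nat_0 mult_zero_left add_0_right)
  then have "real (Suc k) * (\<nu> * \<eta> / (8 * L1\<^sup>2)) \<le> (norm (x 0 - xstar))\<^sup>2"
    by (smt (verit) zero_le_power2)
  then show ?thesis
    using \<nu>_pos \<eta>_pos L1_pos by (simp add: field_simps)
qed

lemma final_iterate_le:
  fixes N :: nat
  defines "T \<equiv> real (card {k\<in>{..<N}. L0 / L1 \<le> norm (grad f (x k))})"
  assumes N: "8 * L1\<^sup>2 * (norm (x 0 - xstar))\<^sup>2 / (\<nu> * \<eta>) - 1 < real N"
  shows "f (x N) - f xstar \<le> 2 * L0 * (norm (x 0 - xstar))\<^sup>2 / (\<eta> * (real N + 1 - T))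
      - \<nu> * L0 * T / (4 * L1\<^sup>2 * (real N + 1 - T))" (is "_ \<le> ?B")
    and "2 * L0 * (norm (x 0 - xstar))\<^sup>2 / (\<eta> * (real N + 1 - T))
      - \<nu> * L0 * T / (4 * L1\<^sup>2 * (real N + 1 - T))
      \<le> 2 * L0 * (norm (x 0 - xstar))\<^sup>2 / (\<eta> * (real N + 1))"
proof -
  define R where "R = (norm (x 0 - xstar))\<^sup>2"
  define c where "c = \<nu> * \<eta> / (8 * L1\<^sup>2)"
  define S where "S = real N + 1 - T"
  have \<nu>_pos: "0 < \<nu>" by (subst \<nu>) simp
  have c: "0 < c" using \<nu>_pos \<eta>_pos L1_pos by (simp add: c_def)
  have card_compl: "real (card {k\<in>{..<m}. \<not> P k}) = real m - real (card {k\<in>{..<m}. P k})"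
    for P and m :: nat
  proof -
    have "card {..<m} = card ({k\<in>{..<m}. P k} \<union> {k\<in>{..<m}. \<not> P k})"
      by (rule arg_cong[of _ _ card]) blast
    also have "\<dots> = card {k\<in>{..<m}. P k} + card {k\<in>{..<m}. \<not> P k}"
      by (rule card_Un_disjoint) auto
    finally show ?thesis by simp
  qed
  have "T \<le> N"
    using card_compl[of N "\<lambda>k. L0 / L1 \<le> norm (grad f (x k))"] by (simp add: T_def)
  then have S: "0 < S" by (simp add: S_def)
  \<comment> \<open>The gradient at index \<open>N\<close> is small, so extending the count from
    \<open>{..<N}\<close> to \<open>{..<Suc N}\<close> leaves \<open>T\<close> unchanged and gives
    exactly \<open>S\<close> steps with a small gradient.\<close>
  have "\<not> L0 / L1 \<le> norm (grad f (x N))"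
    using large_grad_index_le[of N] N by auto
  then have "{k\<in>{..<Suc N}. L0 / L1 \<le> norm (grad f (x k))}
      = {k\<in>{..<N}. L0 / L1 \<le> norm (grad f (x k))}"
    using less_Suc_eq by auto
  then have "(norm (x (Suc N) - xstar))\<^sup>2 + T * c + S * (\<eta> / (2 * L0) * (f (x N) - f xstar)) \<le> R"
    using dist_iterates[of "Suc N" N]
    by (simp only: card_compl T_def c_def R_def S_def of_nat_Suc add.commute[of 1] order.refl)
  then have "S * (\<eta> / (2 * L0) * (f (x N) - f xstar)) \<le> R - T * c"
    by (smt (verit) zero_le_power2)
  then have "f (x N) - f xstar \<le> 2 * L0 / \<eta> * ((R - T * c) / S)"
    using S \<eta>_pos L0_pos by (simp add: field_simps)
  also have B: "\<dots> = ?B"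
    using S \<eta>_pos L1_pos unfolding S_def[symmetric] R_def[symmetric]
    by (simp add: c_def field_simps power2_eq_square)
  finally show "f (x N) - f xstar \<le> ?B" .
  \<comment> \<open>The hypothesis on \<open>N\<close> bounds the average budget
    \<open>R / (N + 1)\<close> by \<open>c\<close>; taking out \<open>T\<close> steps that cost
    \<open>c\<close> each cannot raise the average of what remains.\<close>
  have "R / c < real N + 1"
    using N by (simp add: c_def R_def field_simps)
  then have "R \<le> c * (real N + 1)"
    using c by (simp add: field_simps)
  then have "T * R \<le> T * (c * (real N + 1))"
    by (intro mult_left_mono) (auto simp: T_def)
  then have "(R - T * c) * (real N + 1) \<le> R * S"
    by (simp add: S_def algebra_simps)
  then have "(R - T * c) / S \<le> R / (real N + 1)"
    using S by (simp add: divide_simps mult_ac)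
  then have "2 * L0 / \<eta> * ((R - T * c) / S) \<le> 2 * L0 / \<eta> * (R / (real N + 1))"
    using L0_pos \<eta>_pos by (intro mult_left_mono) auto
  then show "?B \<le> 2 * L0 * (norm (x 0 - xstar))\<^sup>2 / (\<eta> * (real N + 1))"
    unfolding B by (simp add: R_def)
qed

end

end

end

end

theorem theorem3p3:
  fixes f :: "real ^ 'd \<Rightarrow> real"
    and L0 L1 \<nu> \<eta> :: real
    and xstar :: "real ^ 'd"
    and x :: "nat \<Rightarrow> real ^ 'd"
  assumes "f differentiable_on UNIV"
    and "convex_on UNIV f"
    and "L0 > 0" and "L1 > 0"
    and "symmetrically_smooth L0 L1 f"
    and "is_arg_min f (\<lambda>_. True) xstar"
    and "\<nu> = exp (- \<nu>)"
    and "0 < \<eta>" and "\<eta> \<le> \<nu> / 2"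
    and "\<And>k. x (Suc k) = x k - (\<eta> / (L0 + L1 * norm (grad f (x k)))) *\<^sub>R grad f (x k)"
  shows "(\<forall>k. norm (grad f (x k)) \<ge> L0 / L1 \<longrightarrow>
           real k \<le> 8 * L1\<^sup>2 * (norm (x 0 - xstar))\<^sup>2 / (\<nu> * \<eta>) - 1 \<and>
           (norm (x (Suc k) - xstar))\<^sup>2 \<le> (norm (x k - xstar))\<^sup>2 - \<nu> * \<eta> / (8 * L1\<^sup>2)) \<and>
         (\<forall>N. real N > 8 * L1\<^sup>2 * (norm (x 0 - xstar))\<^sup>2 / (\<nu> * \<eta>) - 1 \<longrightarrow>
           (let T = real (card {k \<in> {..<N}. norm (grad f (x k)) \<ge> L0 / L1}) in
             f (x N) - f xstar
               \<le> 2 * L0 * (norm (x 0 - xstar))\<^sup>2 / (\<eta> * (real N + 1 - T))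
                 - \<nu> * L0 * T / (4 * L1\<^sup>2 * (real N + 1 - T)) \<and>
             2 * L0 * (norm (x 0 - xstar))\<^sup>2 / (\<eta> * (real N + 1 - T))
                 - \<nu> * L0 * T / (4 * L1\<^sup>2 * (real N + 1 - T))
               \<le> 2 * L0 * (norm (x 0 - xstar))\<^sup>2 / (\<eta> * (real N + 1))))"
proof -
  interpret convex_symmetrically_smooth f L0 L1
    using assms(1-5) by unfold_locales
  have min: "f xstar \<le> f z" for z
    using assms(6) by (auto simp: is_arg_min_def not_less)
  have step: "x (Suc k) = gd_step \<eta> (x k)" for k
    using assms(10) by (simp add: gd_step_def[OF assms(7-9)] G_def)
  show ?thesis
    unfolding Let_def
    \<comment> \<open>Brings \<open>x (Suc k)\<close> into the form in which
      \<open>dist_gd_step_large_grad\<close> is stated.\<close>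
    unfolding step
    by (intro conjI allI impI large_grad_index_le[where x = x, OF assms(7-9) min step]
        dist_gd_step_large_grad[OF assms(7-9) min]
        final_iterate_le[where x = x, OF assms(7-9) min step])
qed

end
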